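(* Let $L\in K[D_x,D_y]$ be an operator of order three, and let $F_1,F_2\in K[D_x,D_y]$ be first-order operators with $\gcd(\mathrm{Sym}(F_1),\mathrm{Sym}(F_2))=1$. Then $F_1$ is a left factor of $L$ and $F_2$ is a right factor of $L$ if and only if $L$ has a factorization into three factors, the left one of which is exactly $F_1$ and the right one of which is exactly $F_2$, that is, $L=F_1\circ T\circ F_2$ for some $T\in K[D_x,D_y]$.
   Context: $K$ is a field of characteristic zero with commuting derivations $\partial_x,\partial_y$, assumed differentially closed (it contains solutions of the, possibly non-linear, differential equations with coefficients in $K$ that are needed). $K[D_x,D_y]$ is the ring of (bivariate) linear partial differential operators over $K$: $D_x,D_y$ commute with each other, and $D_i a = aD_i+\partial_i(a)$ for $a\in K$, $i \in \{x,y\}$. Multiplication (composition) is denoted $\circ$. For $L=\sum_{i+j\le d}a_{ij}D_x^iD_y^j$ of order $d$, its (principal) symbol is $\mathrm{Sym}(L)=\sum_{i+j=d}a_{ij}X^iY^j\in K[X,Y]$, with $X,Y$ commuting formal variables. An operator $F$ is a left (respectively right) factor of $L$ if $L=F\circ G$ (respectively $L=G\circ F$) for some $G\in K[D_x,D_y]$. *)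

theory Defs
  imports "HOL-Computational_Algebra.Polynomial" "HOL-Algebra.Ring"
begin

class pdiff_field = field_char_0 +
  fixes der_x der_y :: "'a \<Rightarrow> 'a"
  assumes der_x_add: "der_x (a + b) = der_x a + der_x b"
    and der_y_add: "der_y (a + b) = der_y a + der_y b"
    and der_x_mult: "der_x (a * b) = der_x a * b + a * der_x b"
    and der_y_mult: "der_y (a * b) = der_y a * b + a * der_y b"
    and der_commute: "der_x (der_y a) = der_y (der_x a)"


text \<open>
  Differential polynomials over \<open>'a\<close> in the unknowns \<open>Unknown 0, Unknown 1, \<dots>\<close>, written as
  terms.
\<close>

datatype 'a diff_poly =
    Coefficient 'a
  | Unknown nat
  | Plus "'a diff_poly" "'a diff_poly"
  | Times "'a diff_poly" "'a diff_poly"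
  | Der_X "'a diff_poly"
  | Der_Y "'a diff_poly"

primrec eval_diff_poly ::
  "('c, 'm) ring_scheme \<Rightarrow> ('c \<Rightarrow> 'c) \<Rightarrow> ('c \<Rightarrow> 'c) \<Rightarrow> ('a \<Rightarrow> 'c) \<Rightarrow> (nat \<Rightarrow> 'c) \<Rightarrow> 'a diff_poly \<Rightarrow> 'c"
where
  "eval_diff_poly E ex ey \<iota> u (Coefficient a) = \<iota> a"
| "eval_diff_poly E ex ey \<iota> u (Unknown n) = u n"
| "eval_diff_poly E ex ey \<iota> u (Plus p q) =
     eval_diff_poly E ex ey \<iota> u p \<oplus>\<^bsub>E\<^esub> eval_diff_poly E ex ey \<iota> u q"
| "eval_diff_poly E ex ey \<iota> u (Times p q) =
     eval_diff_poly E ex ey \<iota> u p \<otimes>\<^bsub>E\<^esub> eval_diff_poly E ex ey \<iota> u q"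
| "eval_diff_poly E ex ey \<iota> u (Der_X p) = ex (eval_diff_poly E ex ey \<iota> u p)"
| "eval_diff_poly E ex ey \<iota> u (Der_Y p) = ey (eval_diff_poly E ex ey \<iota> u p)"

definition solves_system ::
  "('c, 'm) ring_scheme \<Rightarrow> ('c \<Rightarrow> 'c) \<Rightarrow> ('c \<Rightarrow> 'c) \<Rightarrow> ('a \<Rightarrow> 'c) \<Rightarrow> 'a diff_poly set \<Rightarrow> (nat \<Rightarrow> 'c) \<Rightarrow> bool"
where
  "solves_system E ex ey \<iota> S u \<longleftrightarrow>
     range u \<subseteq> carrier E \<and> (\<forall>p\<in>S. eval_diff_poly E ex ey \<iota> u p = \<zero>\<^bsub>E\<^esub>)"

definition ring_derivation :: "('c, 'm) ring_scheme \<Rightarrow> ('c \<Rightarrow> 'c) \<Rightarrow> bool" where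
  "ring_derivation E d \<longleftrightarrow>
     d \<in> carrier E \<rightarrow> carrier E \<and>
     (\<forall>a\<in>carrier E. \<forall>b\<in>carrier E.
        d (a \<oplus>\<^bsub>E\<^esub> b) = d a \<oplus>\<^bsub>E\<^esub> d b \<and>
        d (a \<otimes>\<^bsub>E\<^esub> b) = (d a \<otimes>\<^bsub>E\<^esub> b) \<oplus>\<^bsub>E\<^esub> (a \<otimes>\<^bsub>E\<^esub> d b))"

definition type_ring :: "'a::comm_ring_1 ring" where
  "type_ring = \<lparr>carrier = UNIV, monoid.mult = (*), one = 1, ring.zero = 0, add = (+)\<rparr>"

definition pdiff_extension ::
  "('c, 'm) ring_scheme \<Rightarrow> ('c \<Rightarrow> 'c) \<Rightarrow> ('c \<Rightarrow> 'c) \<Rightarrow> ('a::pdiff_field \<Rightarrow> 'c) \<Rightarrow> bool"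
where
  "pdiff_extension E ex ey \<iota> \<longleftrightarrow>
     Ring.field E \<and> ring_derivation E ex \<and> ring_derivation E ey \<and>
     (\<forall>a\<in>carrier E. ex (ey a) = ey (ex a)) \<and>
     \<iota> \<in> ring_hom type_ring E \<and>
     (\<forall>a. \<iota> (der_x a) = ex (\<iota> a)) \<and> (\<forall>a. \<iota> (der_y a) = ey (\<iota> a))"

text \<open>
  Every finite system of (nonlinear) differential equations over \<open>'a\<close> that is solvable in some
  differential field extension is solvable in \<open>'a\<close> itself.  Inequations need not be listed:
  \<open>p \<noteq> 0\<close> is the equation \<open>p z = 1\<close> in an additional unknown \<open>z\<close>.  The extension field is a
  ring structure on a subset of \<open>'a\<close>; this is no restriction, since a solution generates
  an extension of the same cardinality as the (infinite) field \<open>'a\<close>.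
\<close>

definition differentially_closed :: "'a::pdiff_field itself \<Rightarrow> bool" where
  "differentially_closed _ \<longleftrightarrow>
     (\<forall>S :: 'a diff_poly set. finite S \<longrightarrow>
        (\<exists>(E :: 'a ring) ex ey \<iota> u. pdiff_extension E ex ey \<iota> \<and> solves_system E ex ey \<iota> S u) \<longrightarrow>
        (\<exists>u. solves_system type_ring der_x der_y id S u))"


text \<open>
  \<open>monomial2 a i j\<close> is \<open>a X\<^sup>i Y\<^sup>j\<close>: the outer variable of \<open>'a poly poly\<close> is \<open>X\<close>,
  the inner one is \<open>Y\<close>.
\<close>

definition monomial2 :: "'a::zero \<Rightarrow> nat \<Rightarrow> nat \<Rightarrow> 'a poly poly" where
  "monomial2 a i j = monom (monom a j) i"

definition coeff2 :: "'a::zero poly poly \<Rightarrow> nat \<Rightarrow> nat \<Rightarrow> 'a" where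
  "coeff2 P i j = coeff (coeff P i) j"

text \<open>
  A polynomial with coefficients \<open>a\<^sub>i\<^sub>j\<close> stands for the operator \<open>\<Sum> a\<^sub>i\<^sub>j D\<^sub>x\<^sup>i D\<^sub>y\<^sup>j\<close>, with coefficients
  on the left.  The relation \<open>D\<^sub>x a = a D\<^sub>x + \<partial>\<^sub>x a\<close> gives
  \<open>D\<^sub>x \<circ> G = X G + (G with \<partial>\<^sub>x applied to its coefficients)\<close>, likewise for \<open>D\<^sub>y\<close>, and hence the
  composition \<open>(\<Sum> a\<^sub>i\<^sub>j D\<^sub>x\<^sup>i D\<^sub>y\<^sup>j) \<circ> G\<close>.
\<close>

definition compose_Dx :: "'a::pdiff_field poly poly \<Rightarrow> 'a poly poly" where
  "compose_Dx G = monomial2 1 1 0 * G + map_poly (map_poly der_x) G"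

definition compose_Dy :: "'a::pdiff_field poly poly \<Rightarrow> 'a poly poly" where
  "compose_Dy G = monomial2 1 0 1 * G + map_poly (map_poly der_y) G"

definition compose :: "'a::pdiff_field poly poly \<Rightarrow> 'a poly poly \<Rightarrow> 'a poly poly" where
  "compose F G =
     (\<Sum>i\<le>degree F. \<Sum>j\<le>degree (coeff F i).
        monomial2 (coeff2 F i j) 0 0 * (compose_Dx ^^ i) ((compose_Dy ^^ j) G))"

lemma coeff2_eqI: "(\<And>i j. coeff2 P i j = coeff2 Q i j) \<Longrightarrow> P = Q"
  by (simp add: coeff2_def poly_eq_iff)

lemma coeff2_simps [simp]:
  "coeff2 0 i j = 0"
  "coeff2 (P + Q) i j = coeff2 P i j + coeff2 Q i j"
  by (simp_all add: coeff2_def)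

lemma coeff2_uminus [simp]:
  fixes P :: "'a::ab_group_add poly poly"
  shows "coeff2 (- P) i j = - coeff2 P i j"
  by (simp add: coeff2_def)

lemma coeff2_monomial2:
  "coeff2 (monomial2 a i j) k l = (if i = k \<and> j = l then a else 0)"
  by (simp add: coeff2_def monomial2_def)

lemma monomial2_0 [simp]: "monomial2 0 i j = 0"
  by (simp add: monomial2_def)

lemma monomial2_add: "monomial2 (a + b) i j = monomial2 a i j + monomial2 b i j"
  by (simp add: monomial2_def add_monom)

lemma monomial2_mult:
  fixes a b :: "'a::comm_semiring_1"
  shows "monomial2 a i j * monomial2 b k l = monomial2 (a * b) (i + k) (j + l)"
  by (simp add: monomial2_def mult_monom)

lemma monomial2_one: "monomial2 1 0 0 = 1"
  by (simp add: monomial2_def)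

lemma poly2_induct [case_names zero add]:
  fixes P :: "'a::comm_monoid_add poly poly"
  assumes z: "Q 0"
    and a: "\<And>b i j R. Q R \<Longrightarrow> Q (monomial2 b i j + R)"
  shows "Q P"
proof -
  have inner: "Q (monom p i + R)" if "Q R" for p :: "'a poly" and i R
  proof -
    have "Q ((\<Sum>j\<in>A. monomial2 (coeff p j) i j) + R)" if "finite A" for A
      using that by (induction A) (auto simp: \<open>Q R\<close> add.assoc intro: a)
    moreover have "(\<Sum>j\<le>degree p. monomial2 (coeff p j) i j) = monom p i"
    proof -
      have "(\<Sum>j\<le>degree p. monomial2 (coeff p j) i j) = monom (\<Sum>j\<le>degree p. monom (coeff p j) j) i"
        unfolding monomial2_def by (intro poly_eqI) (simp add: coeff_sum)
      then show ?thesis by (simp add: poly_as_sum_of_monoms)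
    qed
    ultimately show ?thesis by (metis finite_atMost)
  qed
  have "Q (\<Sum>i\<in>A. monom (coeff P i) i)" if "finite A" for A
    using that by (induction A) (auto simp: z intro: inner)
  from this[of "{..degree P}"] show ?thesis by (simp add: poly_as_sum_of_monoms)
qed

context pdiff_field
begin

lemma der_x_0 [simp]: "der_x 0 = 0" and der_y_0 [simp]: "der_y 0 = 0"
  using der_x_add[of 0 0] der_y_add[of 0 0] by auto

lemma der_x_1 [simp]: "der_x 1 = 0" and der_y_1 [simp]: "der_y 1 = 0"
  using der_x_mult[of 1 1] der_y_mult[of 1 1] by auto

end

lemma map_poly2_add:
  fixes d :: "'a::comm_monoid_add \<Rightarrow> 'a"
  assumes "d 0 = 0" "\<And>a b. d (a + b) = d a + d b"
  shows "map_poly (map_poly d) (P + Q) = map_poly (map_poly d) P + map_poly (map_poly d) Q"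
  by (intro poly_eqI) (simp add: coeff_map_poly assms)

lemma map_poly2_monomial2:
  "d 0 = 0 \<Longrightarrow> map_poly (map_poly d) (monomial2 a i j) = monomial2 (d a) i j"
  by (simp add: monomial2_def map_poly_monom)

lemma compose_Dx_0 [simp]: "compose_Dx 0 = 0" and compose_Dy_0 [simp]: "compose_Dy 0 = 0"
  by (simp_all add: compose_Dx_def compose_Dy_def)

lemma compose_Dx_add: "compose_Dx (F + G) = compose_Dx F + compose_Dx G"
  by (simp add: compose_Dx_def map_poly2_add der_x_add algebra_simps)

lemma compose_Dy_add: "compose_Dy (F + G) = compose_Dy F + compose_Dy G"
  by (simp add: compose_Dy_def map_poly2_add der_y_add algebra_simps)

lemma compose_Dx_monomial2:
  "compose_Dx (monomial2 a i j) = monomial2 a (Suc i) j + monomial2 (der_x a) i j"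
  by (simp add: compose_Dx_def map_poly2_monomial2 monomial2_mult)

lemma compose_Dy_monomial2:
  "compose_Dy (monomial2 a i j) = monomial2 a i (Suc j) + monomial2 (der_y a) i j"
  by (simp add: compose_Dy_def map_poly2_monomial2 monomial2_mult)

lemma compose_Dx_Dy: "compose_Dx (compose_Dy G) = compose_Dy (compose_Dx G)"
  by (induction G rule: poly2_induct)
     (simp_all add: compose_Dx_add compose_Dy_add compose_Dx_monomial2 compose_Dy_monomial2
        der_commute algebra_simps)

lemma compose_Dx_scale:
  "compose_Dx (monomial2 a 0 0 * G) =
     monomial2 a 0 0 * compose_Dx G + monomial2 (der_x a) 0 0 * G"
  by (induction G rule: poly2_induct)
     (simp_all add: compose_Dx_add compose_Dx_monomial2 monomial2_mult der_x_mult monomial2_add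
        algebra_simps)

lemma compose_Dy_scale:
  "compose_Dy (monomial2 a 0 0 * G) =
     monomial2 a 0 0 * compose_Dy G + monomial2 (der_y a) 0 0 * G"
  by (induction G rule: poly2_induct)
     (simp_all add: compose_Dy_add compose_Dy_monomial2 monomial2_mult der_y_mult monomial2_add
        algebra_simps)

lemma funpow_Dx_add: "(compose_Dx ^^ n) (F + G) = (compose_Dx ^^ n) F + (compose_Dx ^^ n) G"
  by (induction n) (simp_all add: compose_Dx_add)

lemma funpow_Dy_add: "(compose_Dy ^^ n) (F + G) = (compose_Dy ^^ n) F + (compose_Dy ^^ n) G"
  by (induction n) (simp_all add: compose_Dy_add)

lemma compose_Dy_funpow_Dx: "compose_Dy ((compose_Dx ^^ n) G) = (compose_Dx ^^ n) (compose_Dy G)"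
  by (induction n) (simp_all add: compose_Dx_Dy[symmetric])

lemma funpow_Dx_0 [simp]: "(compose_Dx ^^ n) 0 = 0" and funpow_Dy_0 [simp]: "(compose_Dy ^^ n) 0 = 0"
  by (induction n) simp_all

lemma compose_bounds:
  assumes "degree F \<le> m" "\<And>i. degree (coeff F i) \<le> n"
  shows "compose F G = (\<Sum>i\<le>m. \<Sum>j\<le>n.
     monomial2 (coeff2 F i j) 0 0 * (compose_Dx ^^ i) ((compose_Dy ^^ j) G))"
proof -
  have inner: "(\<Sum>j\<le>degree (coeff F i).
      monomial2 (coeff2 F i j) 0 0 * (compose_Dx ^^ i) ((compose_Dy ^^ j) G)) =
    (\<Sum>j\<le>n. monomial2 (coeff2 F i j) 0 0 * (compose_Dx ^^ i) ((compose_Dy ^^ j) G))" for i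
    by (rule sum.mono_neutral_left) (use assms(2) in \<open>auto simp: coeff2_def coeff_eq_0\<close>)
  show ?thesis
    unfolding compose_def inner
    by (rule sum.mono_neutral_left) (use assms(1) in \<open>auto simp: coeff2_def coeff_eq_0\<close>)
qed

lemma degree_coeff_bounded: "\<exists>n. \<forall>i. degree (coeff P i) \<le> n"
proof -
  have "degree (coeff P i) \<le> (\<Sum>k\<le>degree P. degree (coeff P k))" for i
  proof (cases "i \<le> degree P")
    case True
    then show ?thesis by (intro member_le_sum) auto
  qed (simp add: coeff_eq_0)
  then show ?thesis by blast
qed

lemma compose_add_left: "compose (F + G) H = compose F H + compose G H"
proof -
  obtain nF nG where nF: "\<And>i. degree (coeff F i) \<le> nF" and nG: "\<And>i. degree (coeff G i) \<le> nG"
    using degree_coeff_bounded by metis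
  define m where "m = max (degree F) (degree G)"
  define n where "n = max nF nG"
  have n: "degree (coeff F i) \<le> n" "degree (coeff G i) \<le> n" for i
    using nF[of i] nG[of i] by (auto simp: n_def)
  have "degree (F + G) \<le> m" "degree F \<le> m" "degree G \<le> m"
    by (auto simp: m_def degree_add_le)
  moreover have "degree (coeff (F + G) i) \<le> n" for i
    using n by (simp add: degree_add_le)
  ultimately show ?thesis
    using n by (simp add: compose_bounds[of _ m n] monomial2_add algebra_simps sum.distrib)
qed

lemma compose_add_right: "compose F (G + H) = compose F G + compose F H"
  unfolding compose_def by (simp add: funpow_Dx_add funpow_Dy_add algebra_simps sum.distrib)

lemma compose_0_left [simp]: "compose 0 G = 0"
  by (simp add: compose_def coeff2_def)

lemma compose_0_right [simp]: "compose F 0 = 0"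
  by (simp add: compose_def)

lemma compose_monomial2:
  "compose (monomial2 a k l) G = monomial2 a 0 0 * (compose_Dx ^^ k) ((compose_Dy ^^ l) G)"
proof -
  let ?f = "\<lambda>i j. monomial2 (coeff2 (monomial2 a k l) i j) 0 0 * (compose_Dx ^^ i) ((compose_Dy ^^ j) G)"
  have "compose (monomial2 a k l) G = (\<Sum>i\<le>k. \<Sum>j\<le>l. ?f i j)"
    by (intro compose_bounds) (auto simp: monomial2_def degree_monom_le)
  also have "\<dots> = (\<Sum>i\<le>k. \<Sum>j\<le>l. if k = i then if l = j then ?f k l else 0 else 0)"
    by (intro sum.cong refl) (auto simp: coeff2_monomial2)
  also have "\<dots> = (\<Sum>i\<le>k. if k = i then (\<Sum>j\<le>l. if l = j then ?f k l else 0) else 0)"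
    by (intro sum.cong refl) auto
  also have "\<dots> = ?f k l" by (simp add: sum.delta')
  finally show ?thesis by (simp add: coeff2_monomial2)
qed

lemma compose_compose_Dx: "compose (compose_Dx F) G = compose_Dx (compose F G)"
  by (induction F rule: poly2_induct)
     (simp_all add: compose_Dx_add compose_Dx_monomial2 compose_add_left compose_monomial2
        compose_Dx_scale)

lemma compose_compose_Dy: "compose (compose_Dy F) G = compose_Dy (compose F G)"
  by (induction F rule: poly2_induct)
     (simp_all add: compose_Dy_add compose_Dy_monomial2 compose_add_left compose_monomial2
        compose_Dy_scale compose_Dy_funpow_Dx)

lemma compose_scale: "compose (monomial2 a 0 0 * F) G = monomial2 a 0 0 * compose F G"
  by (induction F rule: poly2_induct)
     (simp_all add: compose_add_left compose_monomial2 monomial2_mult algebra_simps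
        flip: mult.assoc)

lemma compose_funpow_Dx: "compose ((compose_Dx ^^ n) F) G = (compose_Dx ^^ n) (compose F G)"
  by (induction n) (simp_all add: compose_compose_Dx)

lemma compose_funpow_Dy: "compose ((compose_Dy ^^ n) F) G = (compose_Dy ^^ n) (compose F G)"
  by (induction n) (simp_all add: compose_compose_Dy)

lemma compose_assoc: "compose (compose F G) H = compose F (compose G H)"
  by (induction F rule: poly2_induct)
     (simp_all add: compose_add_left compose_monomial2 compose_scale compose_funpow_Dx
        compose_funpow_Dy)

lemma compose_1_left: "compose 1 G = G"
  using compose_monomial2[of 1 0 0 G] by (simp add: monomial2_one)

lemma funpow_Dy_1: "(compose_Dy ^^ j) 1 = monomial2 1 0 j"
  by (induction j) (simp_all add: compose_Dy_monomial2 monomial2_one)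

lemma funpow_Dx_monomial2_1: "(compose_Dx ^^ i) (monomial2 1 0 j) = monomial2 1 i j"
  by (induction i) (simp_all add: compose_Dx_monomial2)

lemma compose_1_right: "compose F 1 = F"
  by (induction F rule: poly2_induct)
     (simp_all add: compose_add_left compose_monomial2 funpow_Dy_1 funpow_Dx_monomial2_1
        monomial2_mult)


text \<open>
  The ring \<open>K[D\<^sub>x, D\<^sub>y]\<close>.  It is a type of its own because its multiplication differs from that
  of \<open>'a poly poly\<close>.
\<close>

typedef (overloaded) 'a lpdo = "UNIV :: 'a::zero poly poly set"
  morphisms poly_of_lpdo Lpdo ..

setup_lifting type_definition_lpdo

instantiation lpdo :: (pdiff_field) ring_1
begin

lift_definition zero_lpdo :: "'a lpdo" is 0 .
lift_definition one_lpdo :: "'a lpdo" is 1 .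
lift_definition plus_lpdo :: "'a lpdo \<Rightarrow> 'a lpdo \<Rightarrow> 'a lpdo" is "(+)" .
lift_definition minus_lpdo :: "'a lpdo \<Rightarrow> 'a lpdo \<Rightarrow> 'a lpdo" is "(-)" .
lift_definition uminus_lpdo :: "'a lpdo \<Rightarrow> 'a lpdo" is uminus .
lift_definition times_lpdo :: "'a lpdo \<Rightarrow> 'a lpdo \<Rightarrow> 'a lpdo" is compose .

instance
  by standard
     (transfer; simp add: compose_assoc compose_1_left compose_1_right compose_add_left
        compose_add_right)+

end

lift_definition lpdo_coeff :: "'a::zero lpdo \<Rightarrow> nat \<Rightarrow> nat \<Rightarrow> 'a" is coeff2 .

lift_definition lpdo_const :: "'a::zero \<Rightarrow> 'a lpdo" is "\<lambda>a. monomial2 a 0 0" .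

lift_definition Dx :: "'a::pdiff_field lpdo" is "monomial2 1 1 0" .

lift_definition Dy :: "'a::pdiff_field lpdo" is "monomial2 1 0 1" .

lemma Dx_Dy_commute: "Dx * Dy = Dy * Dx"
  by transfer (simp add: compose_monomial2 compose_Dx_monomial2 compose_Dy_monomial2 monomial2_mult
      monomial2_one)

lemma Dx_const: "Dx * lpdo_const a = lpdo_const a * Dx + lpdo_const (der_x a)"
  by transfer (simp add: compose_monomial2 compose_Dx_monomial2 monomial2_mult monomial2_one)

lemma Dy_const: "Dy * lpdo_const a = lpdo_const a * Dy + lpdo_const (der_y a)"
  by transfer (simp add: compose_monomial2 compose_Dy_monomial2 monomial2_mult monomial2_one)

lemma lpdo_const_add: "lpdo_const (a + b) = lpdo_const a + lpdo_const (b :: 'a::pdiff_field)"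
  by transfer (simp add: monomial2_add)

lemma lpdo_const_mult: "lpdo_const (a * b) = lpdo_const a * lpdo_const b"
  by transfer (simp add: compose_monomial2 monomial2_mult)

lemma lpdo_const_1: "lpdo_const 1 = 1"
  by transfer (simp add: monomial2_one)

lemma lpdo_coeff_eqI: "(\<And>i j. lpdo_coeff F i j = lpdo_coeff G i j) \<Longrightarrow> F = G"
  by transfer (rule coeff2_eqI)

lemma Dx_power_Dy_power: "poly_of_lpdo (lpdo_const a * Dx ^ i * Dy ^ j) = monomial2 a i j"
proof -
  have x: "poly_of_lpdo (Dx ^ i * F) = (compose_Dx ^^ i) (poly_of_lpdo F)" for i and F :: "'a lpdo"
    by (induction i arbitrary: F)
       (simp_all add: mult.assoc times_lpdo.rep_eq Dx.rep_eq compose_monomial2 monomial2_one)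
  have y: "poly_of_lpdo (Dy ^ j * F) = (compose_Dy ^^ j) (poly_of_lpdo F)" for j and F :: "'a lpdo"
    by (induction j arbitrary: F)
       (simp_all add: mult.assoc times_lpdo.rep_eq Dy.rep_eq compose_monomial2 monomial2_one)
  show ?thesis
    using x[of i "Dy ^ j"] y[of j 1]
    by (simp add: mult.assoc times_lpdo.rep_eq lpdo_const.rep_eq compose_monomial2
        one_lpdo.rep_eq funpow_Dy_1 funpow_Dx_monomial2_1 monomial2_mult)
qed

lemma lpdo_coeff_monomial:
  "lpdo_coeff (lpdo_const a * Dx ^ i * Dy ^ j) k l = (if i = k \<and> j = l then a else 0)"
  by (simp add: lpdo_coeff.rep_eq Dx_power_Dy_power coeff2_monomial2)

text \<open>The zero operator gets order \<open>0\<close>; an operator of positive order is nonzero.\<close>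

definition lpdo_order :: "'a::zero lpdo \<Rightarrow> nat" where
  "lpdo_order L = Max (insert 0 {i + j | i j. lpdo_coeff L i j \<noteq> 0})"

definition lpdo_symbol :: "'a::comm_monoid_add lpdo \<Rightarrow> 'a poly poly" where
  "lpdo_symbol L =
     (\<Sum>i\<le>lpdo_order L. monomial2 (lpdo_coeff L i (lpdo_order L - i)) i (lpdo_order L - i))"

lemma finite_lpdo_support: "finite {i + j | i j. lpdo_coeff L i j \<noteq> 0}"
proof -
  obtain n where n: "\<And>i. degree (coeff (poly_of_lpdo L) i) \<le> n"
    using degree_coeff_bounded by metis
  have "i + j \<le> degree (poly_of_lpdo L) + n" if nz: "lpdo_coeff L i j \<noteq> 0" for i j
  proof (rule add_mono)
    show "i \<le> degree (poly_of_lpdo L)"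
      using nz by (intro le_degree) (auto simp: lpdo_coeff.rep_eq coeff2_def)
    have "j \<le> degree (coeff (poly_of_lpdo L) i)"
      using nz by (intro le_degree) (auto simp: lpdo_coeff.rep_eq coeff2_def)
    then show "j \<le> n" using n[of i] by simp
  qed
  then have "{i + j | i j. lpdo_coeff L i j \<noteq> 0} \<subseteq> {..degree (poly_of_lpdo L) + n}"
    by blast
  then show ?thesis
    by (rule finite_subset) (rule finite_atMost)
qed

definition left_factor :: "'r::ring_1 \<Rightarrow> 'r \<Rightarrow> bool" where
  "left_factor F L \<longleftrightarrow> (\<exists>G. L = F * G)"

definition right_factor :: "'r::ring_1 \<Rightarrow> 'r \<Rightarrow> bool" where
  "right_factor F L \<longleftrightarrow> (\<exists>G. L = G * F)"

end

theory Submission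
  imports Defs
begin

text \<open>
  Write \<open>L = F\<^sub>1 A = B F\<^sub>2\<close>.  The claim is that \<open>A = T F\<^sub>2\<close> and \<open>B = F\<^sub>1 T\<close> for a common \<open>T\<close>.  Symbols
  multiply like commuting polynomials, so if \<open>f\<close> and \<open>g\<close> are the homogeneous parts of a common
  degree \<open>n\<close>, bounding the orders of \<open>A\<close> and \<open>B\<close>, and \<open>l\<^sub>1\<close>, \<open>l\<^sub>2\<close> are the symbols of \<open>F\<^sub>1\<close>, \<open>F\<^sub>2\<close>, then
  \<open>l\<^sub>1 f = l\<^sub>2 g\<close>.  Since \<open>l\<^sub>1\<close> and \<open>l\<^sub>2\<close> are coprime, \<open>f = l\<^sub>2 t\<close> and \<open>g = l\<^sub>1 t\<close> for some form \<open>t\<close> of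
  degree \<open>n - 1\<close> (\<open>cross_multiplied_linear_forms\<close>).  Lift \<open>t\<close> to an operator \<open>T\<^sub>0\<close>.  The operators
  \<open>A - T\<^sub>0 F\<^sub>2\<close> and \<open>B - F\<^sub>1 T\<^sub>0\<close> have order less than \<open>n\<close> and satisfy the same relation, because
  \<open>F\<^sub>1 (A - T\<^sub>0 F\<^sub>2) = F\<^sub>1 A - F\<^sub>1 T\<^sub>0 F\<^sub>2 = (B - F\<^sub>1 T\<^sub>0) F\<^sub>2\<close>.  Descent on the order therefore
  reduces both operators to \<open>0\<close>, and \<open>T\<close> is the sum of the \<open>T\<^sub>0\<close> used on the way
  (\<open>common_multiple_factors\<close>).  Lower order terms never obstruct, since the same cancellation is
  available at every order.

  Forms of degree \<open>n\<close> in \<open>X, Y\<close> are handled as polynomials of degree at most \<open>n\<close> in \<open>X\<close>, by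
  setting \<open>Y = 1\<close>.  A factor \<open>Y\<close> of the form then shows up as a degree drop, so degree bounds have
  to be tracked along with the divisibility.
\<close>

section \<open>Coefficients of products\<close>

lemma lpdo_coeff_0 [simp]: "lpdo_coeff (0 :: 'a::pdiff_field lpdo) i j = 0"
  by transfer simp

lemma lpdo_coeff_add [simp]:
  "lpdo_coeff (F + G :: 'a::pdiff_field lpdo) i j = lpdo_coeff F i j + lpdo_coeff G i j"
  by transfer simp

lemma lpdo_coeff_diff [simp]:
  "lpdo_coeff (F - G :: 'a::pdiff_field lpdo) i j = lpdo_coeff F i j - lpdo_coeff G i j"
  by transfer (simp add: coeff2_def)

lemma lpdo_coeff_sum:
  "lpdo_coeff (\<Sum>x\<in>S. F x :: 'a::pdiff_field lpdo) i j = (\<Sum>x\<in>S. lpdo_coeff (F x) i j)"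
  by (induction S rule: infinite_finite_induct) simp_all

lemma coeff2_monomial2_mult:
  fixes G :: "'a::comm_semiring_1 poly poly"
  shows "coeff2 (monomial2 a k l * G) i j =
    (if k \<le> i \<and> l \<le> j then a * coeff2 G (i - k) (j - l) else 0)"
  by (simp add: coeff2_def monomial2_def coeff_monom_mult)

lemma coeff2_map_poly:
  "d 0 = 0 \<Longrightarrow> coeff2 (map_poly (map_poly d) G) i j = d (coeff2 G i j)"
  by (simp add: coeff2_def coeff_map_poly)

lemma lpdo_coeff_const_mult [simp]:
  "lpdo_coeff (lpdo_const a * G) i j = a * lpdo_coeff G i j"
  by transfer (simp add: compose_monomial2 coeff2_monomial2_mult)

lemma lpdo_coeff_Dx_mult:
  "lpdo_coeff (Dx * G) i j =
     (if i = 0 then 0 else lpdo_coeff G (i - 1) j) + der_x (lpdo_coeff G i j)"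
  by transfer
     (simp add: compose_monomial2 monomial2_one compose_Dx_def coeff2_monomial2_mult
        coeff2_map_poly)

lemma lpdo_coeff_Dy_mult:
  "lpdo_coeff (Dy * G) i j =
     (if j = 0 then 0 else lpdo_coeff G i (j - 1)) + der_y (lpdo_coeff G i j)"
  by transfer
     (simp add: compose_monomial2 monomial2_one compose_Dy_def coeff2_monomial2_mult
        coeff2_map_poly)

section \<open>Leading forms and their multiplicativity\<close>

text \<open>
  A strict bound, so that \<open>order_below 0\<close> singles out the zero operator, which ends the descent.
\<close>

definition order_below :: "nat \<Rightarrow> 'a::zero lpdo \<Rightarrow> bool" where
  "order_below n L \<longleftrightarrow> (\<forall>i j. n \<le> i + j \<longrightarrow> lpdo_coeff L i j = 0)"

text \<open>
  The homogeneous part of degree \<open>n\<close>, dehomogenised by \<open>Y = 1\<close>.  The degree is an argument,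
  rather than the order of \<open>L\<close>, so that the map is additive.
\<close>

definition leading_form :: "nat \<Rightarrow> 'a::comm_monoid_add lpdo \<Rightarrow> 'a poly" where
  "leading_form n L = (\<Sum>i\<le>n. monom (lpdo_coeff L i (n - i)) i)"

lemma coeff_leading_form:
  "coeff (leading_form n L) i = (if i \<le> n then lpdo_coeff L i (n - i) else 0)"
  by (simp add: leading_form_def coeff_sum)

lemma order_belowD: "order_below n L \<Longrightarrow> n \<le> i + j \<Longrightarrow> lpdo_coeff L i j = 0"
  by (simp add: order_below_def)

lemma order_below_0_iff: "order_below 0 L \<longleftrightarrow> L = (0 :: 'a::pdiff_field lpdo)"
  by (auto simp: order_below_def intro: lpdo_coeff_eqI)

lemma order_below_mono: "order_below m L \<Longrightarrow> m \<le> n \<Longrightarrow> order_below n L"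
  by (auto simp: order_below_def)

lemma order_below_diff:
  "order_below n F \<Longrightarrow> order_below n G \<Longrightarrow> order_below n (F - G :: 'a::pdiff_field lpdo)"
  by (simp add: order_below_def)

lemma order_below_sum:
  "(\<And>x. x \<in> S \<Longrightarrow> order_below n (F x :: 'a::pdiff_field lpdo)) \<Longrightarrow> order_below n (\<Sum>x\<in>S. F x)"
  by (simp add: order_below_def lpdo_coeff_sum)

lemma order_below_lpdo_order: "order_below (Suc (lpdo_order L)) L"
proof -
  have "i + j \<le> lpdo_order L" if "lpdo_coeff L i j \<noteq> 0" for i j
    unfolding lpdo_order_def using that finite_lpdo_support[of L] by (intro Max_ge) auto
  then show ?thesis
    by (force simp: order_below_def)
qed

lemma leading_form_diff:
  "leading_form n (F - G) = leading_form n F - leading_form n (G :: 'a::pdiff_field lpdo)"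
  by (rule poly_eqI) (simp add: coeff_leading_form)

lemma leading_form_sum:
  "leading_form n (\<Sum>x\<in>S. F x) = (\<Sum>x\<in>S. leading_form n (F x :: 'a::pdiff_field lpdo))"
  by (rule poly_eqI) (simp add: coeff_leading_form coeff_sum lpdo_coeff_sum)

lemma leading_form_eq_0: "order_below n L \<Longrightarrow> leading_form n L = 0"
  by (rule poly_eqI) (simp add: coeff_leading_form order_belowD)

lemma order_below_reduce:
  assumes "order_below (Suc n) L" "leading_form n L = 0"
  shows "order_below n L"
  unfolding order_below_def
proof (intro allI impI)
  fix i j assume "n \<le> i + j"
  show "lpdo_coeff L i j = 0"
  proof (cases "n = i + j")
    case True
    then show ?thesis
      using coeff_leading_form[of n L i] assms(2) by simp
  next
    case False
    then show ?thesis
      using \<open>n \<le> i + j\<close> assms(1) by (simp add: order_belowD)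
  qed
qed

text \<open>
  The term \<open>\<partial>\<^sub>x\<close> of a coefficient in \<open>D\<^sub>x a = a D\<^sub>x + \<partial>\<^sub>x a\<close> lies one degree below the leading one.
\<close>

lemma leading_form_Dx_mult:
  assumes "order_below (Suc n) G"
  shows "order_below (Suc (Suc n)) (Dx * G)"
    and "leading_form (Suc n) (Dx * G) = monom 1 1 * leading_form n G"
proof -
  show "order_below (Suc (Suc n)) (Dx * G)"
    using assms by (auto simp: order_below_def lpdo_coeff_Dx_mult)
  show "leading_form (Suc n) (Dx * G) = monom 1 1 * leading_form n G"
    using assms
    by (intro poly_eqI)
       (auto simp: coeff_leading_form coeff_monom_mult lpdo_coeff_Dx_mult order_belowD Suc_diff_le)
qed

lemma leading_form_Dy_mult:
  assumes "order_below (Suc n) G"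
  shows "order_below (Suc (Suc n)) (Dy * G)"
    and "leading_form (Suc n) (Dy * G) = leading_form n G"
proof -
  show "order_below (Suc (Suc n)) (Dy * G)"
    using assms by (auto simp: order_below_def lpdo_coeff_Dy_mult)
  show "leading_form (Suc n) (Dy * G) = leading_form n G"
    using assms
    by (intro poly_eqI)
       (auto simp: coeff_leading_form lpdo_coeff_Dy_mult order_belowD Suc_diff_le)
qed

lemma leading_form_Dx_power_mult:
  assumes "order_below (Suc n) G"
  shows "order_below (Suc (k + n)) (Dx ^ k * G) \<and>
         leading_form (k + n) (Dx ^ k * G) = monom 1 k * leading_form n G"
proof (induction k)
  case 0
  then show ?case using assms by simp
next
  case (Suc k)
  then show ?case
    by (simp add: mult.assoc leading_form_Dx_mult mult_monom flip: mult.assoc[of "monom _ _"])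
qed

lemma leading_form_Dy_power_mult:
  assumes "order_below (Suc n) G"
  shows "order_below (Suc (k + n)) (Dy ^ k * G) \<and>
         leading_form (k + n) (Dy ^ k * G) = leading_form n G"
proof (induction k)
  case 0
  then show ?case using assms by simp
next
  case (Suc k)
  then show ?case by (simp add: mult.assoc leading_form_Dy_mult)
qed

lemma leading_form_monomial_mult:
  assumes "order_below (Suc n) G"
  shows "order_below (Suc (k + l + n)) (lpdo_const a * Dx ^ k * Dy ^ l * G)"
    and "leading_form (k + l + n) (lpdo_const a * Dx ^ k * Dy ^ l * G) = monom a k * leading_form n G"
proof -
  let ?M = "Dx ^ k * (Dy ^ l * G)"
  have y: "order_below (Suc (l + n)) (Dy ^ l * G)" "leading_form (l + n) (Dy ^ l * G) = leading_form n G"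
    using leading_form_Dy_power_mult[OF assms] by auto
  have x: "order_below (Suc (k + l + n)) ?M"
    "leading_form (k + l + n) ?M = monom 1 k * leading_form n G"
    using leading_form_Dx_power_mult[OF y(1), of k] y(2) by (simp_all add: add.assoc)
  have c: "leading_form m (lpdo_const a * ?M) = smult a (leading_form m ?M)" for m
    by (rule poly_eqI) (simp add: coeff_leading_form)
  have "leading_form (k + l + n) (lpdo_const a * ?M) = monom a k * leading_form n G"
    by (simp add: c x(2) smult_monom flip: mult_smult_left)
  then show "leading_form (k + l + n) (lpdo_const a * Dx ^ k * Dy ^ l * G) = monom a k * leading_form n G"
    by (simp add: mult.assoc)
  have "order_below (Suc (k + l + n)) (lpdo_const a * ?M)"
    using x(1) by (simp add: order_below_def)
  then show "order_below (Suc (k + l + n)) (lpdo_const a * Dx ^ k * Dy ^ l * G)"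
    by (simp add: mult.assoc)
qed

lemma lpdo_as_sum_of_monomials:
  fixes L :: "'a::pdiff_field lpdo"
  assumes "order_below (Suc m) L"
  shows "L = (\<Sum>k\<le>m. \<Sum>l\<le>m - k. lpdo_const (lpdo_coeff L k l) * Dx ^ k * Dy ^ l)"
proof (rule lpdo_coeff_eqI)
  fix i j
  have "lpdo_coeff (\<Sum>k\<le>m. \<Sum>l\<le>m - k. lpdo_const (lpdo_coeff L k l) * Dx ^ k * Dy ^ l) i j =
      (\<Sum>k\<le>m. if k = i then \<Sum>l\<le>m - k. if l = j then lpdo_coeff L k l else 0 else 0)"
    unfolding lpdo_coeff_sum lpdo_coeff_monomial by (intro sum.cong refl) auto
  also have "\<dots> = lpdo_coeff L i j"
    using assms by (auto simp: order_below_def)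
  finally show "lpdo_coeff L i j =
      lpdo_coeff (\<Sum>k\<le>m. \<Sum>l\<le>m - k. lpdo_const (lpdo_coeff L k l) * Dx ^ k * Dy ^ l) i j"
    by simp
qed

text \<open>
  Symbols are multiplicative because, among the monomials of \<open>F\<close>, only those of top degree \<open>m\<close>
  reach degree \<open>m + n\<close>, and their commutators with the coefficients of \<open>G\<close> lie in lower degree.
\<close>

lemma leading_form_mult:
  fixes F G :: "'a::pdiff_field lpdo"
  assumes F: "order_below (Suc m) F" and G: "order_below (Suc n) G"
  shows "order_below (Suc (m + n)) (F * G)"
    and "leading_form (m + n) (F * G) = leading_form m F * leading_form n G"
proof -
  define M where "M k l = lpdo_const (lpdo_coeff F k l) * Dx ^ k * Dy ^ l * G" for k l
  have FG: "F * G = (\<Sum>k\<le>m. \<Sum>l\<le>m - k. M k l)"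
    unfolding M_def by (subst (1) lpdo_as_sum_of_monomials[OF F]) (simp add: sum_distrib_right)
  have ord: "order_below (Suc (k + l + n)) (M k l)" for k l
    unfolding M_def by (rule leading_form_monomial_mult(1)[OF G])
  show "order_below (Suc (m + n)) (F * G)"
    unfolding FG by (intro order_below_sum order_below_mono[OF ord]) auto
  have "leading_form (m + n) (M k l) =
      (if l = m - k then monom (lpdo_coeff F k l) k * leading_form n G else 0)"
    if "k \<le> m" "l \<le> m - k" for k l
  proof (cases "l = m - k")
    case True
    then show ?thesis
      using leading_form_monomial_mult(2)[OF G, of k l "lpdo_coeff F k l"] that
      by (simp add: M_def)
  next
    case False
    then show ?thesis
      using that by (simp add: leading_form_eq_0[OF order_below_mono[OF ord]])
  qed
  then have "leading_form (m + n) (F * G) =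
      (\<Sum>k\<le>m. \<Sum>l\<le>m - k. if l = m - k then monom (lpdo_coeff F k l) k * leading_form n G else 0)"
    unfolding FG leading_form_sum by (intro sum.cong refl) auto
  also have "\<dots> = leading_form m F * leading_form n G"
    by (simp add: leading_form_def[of m F] sum_distrib_right)
  finally show "leading_form (m + n) (F * G) = leading_form m F * leading_form n G" .
qed

lemma obtain_lpdo_with_leading_form:
  fixes t :: "'a::pdiff_field poly"
  assumes "\<And>i. m < i \<Longrightarrow> coeff t i = 0"
  obtains T where "order_below (Suc m) T" "leading_form m T = t"
proof
  let ?T = "\<Sum>k\<le>m. lpdo_const (coeff t k) * Dx ^ k * Dy ^ (m - k)"
  have c: "lpdo_coeff ?T i j = (if i + j = m then coeff t i else 0)" for i j
  proof -
    have "lpdo_coeff ?T i j = (\<Sum>k\<le>m. if k = i then if i + j = m then coeff t i else 0 else 0)"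
      unfolding lpdo_coeff_sum lpdo_coeff_monomial by (intro sum.cong refl) auto
    then show ?thesis by simp
  qed
  show "order_below (Suc m) ?T"
    by (simp add: order_below_def c)
  show "leading_form m ?T = t"
    using assms by (intro poly_eqI) (simp add: coeff_leading_form c)
qed

section \<open>Coprime linear forms\<close>

text \<open>
  If \<open>l\<^sub>1 f = l\<^sub>2 g\<close> for independent linear forms, then \<open>l\<^sub>2\<close> divides \<open>f\<close> and \<open>l\<^sub>1\<close> divides \<open>g\<close> with the
  same quotient.  Eliminating \<open>X\<close> from \<open>l\<^sub>1\<close> and \<open>l\<^sub>2\<close> writes the determinant, a constant once
  \<open>Y = 1\<close>, as \<open>a\<^sub>2 l\<^sub>1 - a\<^sub>1 l\<^sub>2\<close>; multiplied by \<open>f\<close> this gives \<open>l\<^sub>2 (a\<^sub>2 g - a\<^sub>1 f)\<close>, and multiplied by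
  \<open>g\<close> it gives \<open>l\<^sub>1 (a\<^sub>2 g - a\<^sub>1 f)\<close>.  The coefficients of degree \<open>n + 1\<close> in \<open>l\<^sub>1 f = l\<^sub>2 g\<close> say that the
  quotient has degree less than \<open>n\<close>; without this it would not be a form of degree \<open>n - 1\<close>.
\<close>

lemma cross_multiplied_linear_forms:
  fixes f g :: "'a::field poly"
  assumes eq: "[:b1, a1:] * f = [:b2, a2:] * g" and det: "a2 * b1 - a1 * b2 \<noteq> 0"
    and f: "\<And>i. n < i \<Longrightarrow> coeff f i = 0" and g: "\<And>i. n < i \<Longrightarrow> coeff g i = 0"
  obtains t where "f = [:b2, a2:] * t" "g = [:b1, a1:] * t" "\<And>i. n \<le> i \<Longrightarrow> coeff t i = 0"
proof
  define d where "d = a2 * b1 - a1 * b2"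
  define s where "s = smult a2 g - smult a1 f"
  have d: "d \<noteq> 0" using det by (simp add: d_def)
  have elim: "[:d:] = smult a2 [:b1, a1:] - smult a1 [:b2, a2:]"
    by (simp add: d_def algebra_simps)
  have "smult d f = [:d:] * f" by simp
  also have "\<dots> = smult a2 ([:b1, a1:] * f) - smult a1 ([:b2, a2:] * f)"
    unfolding elim by (simp only: left_diff_distrib mult_smult_left)
  also have "\<dots> = [:b2, a2:] * s"
    unfolding eq s_def by (simp only: right_diff_distrib mult_smult_right)
  finally have f': "smult d f = [:b2, a2:] * s" .
  have "smult d g = [:d:] * g" by simp
  also have "\<dots> = smult a2 ([:b1, a1:] * g) - smult a1 ([:b2, a2:] * g)"
    unfolding elim by (simp only: left_diff_distrib mult_smult_left)
  also have "\<dots> = [:b1, a1:] * s"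
    unfolding eq[symmetric] s_def by (simp only: right_diff_distrib mult_smult_right)
  finally have g': "smult d g = [:b1, a1:] * s" .
  show "f = [:b2, a2:] * smult (inverse d) s"
    unfolding mult_smult_right f'[symmetric] using d by simp
  show "g = [:b1, a1:] * smult (inverse d) s"
    unfolding mult_smult_right g'[symmetric] using d by simp
  have "coeff ([:b1, a1:] * f) (Suc n) = coeff ([:b2, a2:] * g) (Suc n)"
    by (simp only: eq)
  then have "a1 * coeff f n = a2 * coeff g n"
    using f g by simp
  then show "coeff (smult (inverse d) s) i = 0" if "n \<le> i" for i
    using that f g by (cases "i = n") (simp_all add: s_def)
qed

text \<open>
  If the symbols were proportional, one of them would divide the other and hence be a common
  factor; but a linear form is no unit because it vanishes at the origin.
\<close>

lemma coprime_symbols_imp_det_nonzero: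
  fixes F1 F2 :: "'a::pdiff_field lpdo"
  assumes F1: "lpdo_order F1 = 1" and F2: "lpdo_order F2 = 1"
    and cop: "coprime (lpdo_symbol F1) (lpdo_symbol F2)"
  shows "lpdo_coeff F2 1 0 * lpdo_coeff F1 0 1 - lpdo_coeff F1 1 0 * lpdo_coeff F2 0 1 \<noteq> 0"
proof
  assume det: "lpdo_coeff F2 1 0 * lpdo_coeff F1 0 1 - lpdo_coeff F1 1 0 * lpdo_coeff F2 0 1 = 0"
  have sym: "lpdo_symbol F = [:[:0, lpdo_coeff F 0 1:], [:lpdo_coeff F 1 0:]:]"
    if "lpdo_order F = 1" for F :: "'a lpdo"
    by (rule poly_eqI)
       (simp add: lpdo_symbol_def that monomial2_def coeff_pCons monom_Suc monom_0 split: nat.split)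
  have not_unit: "\<not> is_unit (lpdo_symbol F)" if "lpdo_order F = 1" for F :: "'a lpdo"
  proof
    assume "is_unit (lpdo_symbol F)"
    then obtain Q where "1 = lpdo_symbol F * Q" by (rule dvdE)
    then have "poly (poly (lpdo_symbol F * Q) 0) 0 = 1" by (metis poly_1)
    then show False by (simp add: sym[OF that])
  qed
  consider "lpdo_coeff F2 1 0 \<noteq> 0" | "lpdo_coeff F2 0 1 \<noteq> 0" | "lpdo_symbol F2 = 0"
    unfolding sym[OF F2] by auto
  then have "lpdo_symbol F2 dvd lpdo_symbol F1 \<or> lpdo_symbol F1 dvd lpdo_symbol F2"
  proof cases
    case 1
    then have "lpdo_symbol F1 = [:[:lpdo_coeff F1 1 0 / lpdo_coeff F2 1 0:]:] * lpdo_symbol F2"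
      using det by (simp add: sym F1 F2 field_simps)
    then show ?thesis by (metis dvd_triv_right)
  next
    case 2
    then have "lpdo_symbol F1 = [:[:lpdo_coeff F1 0 1 / lpdo_coeff F2 0 1:]:] * lpdo_symbol F2"
      using det by (simp add: sym F1 F2 field_simps)
    then show ?thesis by (metis dvd_triv_right)
  next
    case 3
    then show ?thesis by simp
  qed
  with cop have "is_unit (lpdo_symbol F1) \<or> is_unit (lpdo_symbol F2)"
    by (meson coprime_def dvd_refl)
  with not_unit F1 F2 show False by blast
qed

section \<open>Common multiples of two operators with coprime symbols\<close>

text \<open>
  Induction on \<open>n\<close>.  Bounding \<open>A\<close> and \<open>B\<close> by the same \<open>n\<close> keeps
  the situation symmetric: one quotient form lowers both bounds at once.
\<close>

lemma common_multiple_factors_bounded: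
  fixes F1 F2 A B :: "'a::pdiff_field lpdo"
  assumes F1: "order_below 2 F1" and F2: "order_below 2 F2"
    and det: "lpdo_coeff F2 1 0 * lpdo_coeff F1 0 1 - lpdo_coeff F1 1 0 * lpdo_coeff F2 0 1 \<noteq> 0"
    and "order_below n A" "order_below n B" "F1 * A = B * F2"
  shows "\<exists>T. A = T * F2 \<and> B = F1 * T"
  using assms(4-6)
proof (induction n arbitrary: A B)
  case 0
  then show ?case by (auto simp: order_below_0_iff intro: exI[of _ 0])
next
  case (Suc n)
  have F: "order_below (Suc 1) F1" "order_below (Suc 1) F2"
    using F1 F2 by (simp_all add: numeral_2_eq_2)
  have lin: "leading_form 1 F = [:lpdo_coeff F 0 1, lpdo_coeff F 1 0:]" for F :: "'a lpdo"
    by (rule poly_eqI) (auto simp: coeff_leading_form coeff_pCons split: nat.split)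
  have "leading_form 1 F1 * leading_form n A = leading_form (1 + n) (F1 * A)"
    using leading_form_mult(2)[OF F(1) Suc.prems(1)] by simp
  also have "\<dots> = leading_form 1 F2 * leading_form n B"
    unfolding Suc.prems(3) using leading_form_mult(2)[OF Suc.prems(2) F(2)]
    by (simp add: mult.commute)
  finally obtain t where t: "leading_form n A = leading_form 1 F2 * t"
      "leading_form n B = leading_form 1 F1 * t" "\<And>i. n \<le> i \<Longrightarrow> coeff t i = 0"
    unfolding lin
    using cross_multiplied_linear_forms[OF _ det, of "leading_form n A" "leading_form n B" n]
    by (auto simp: coeff_leading_form)
  obtain T where T: "order_below n (A - T * F2)" "order_below n (B - F1 * T)"
  proof (cases n)
    \<comment> \<open>There are no forms of degree \<open>-1\<close>; here \<open>t = 0\<close> and the two operators already vanish.\<close>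
    case 0
    then have "t = 0" using t(3) by (intro poly_eqI) simp
    then have "order_below n A" "order_below n B"
      using t Suc.prems by (auto intro: order_below_reduce)
    then show ?thesis using that[of 0] by simp
  next
    case (Suc m)
    obtain T where T: "order_below (Suc m) T" "leading_form m T = t"
      using obtain_lpdo_with_leading_form[of m t] t(3) Suc by auto
    note TF2 = leading_form_mult[OF T(1) F(2)] and F1T = leading_form_mult[OF F(1) T(1)]
    show ?thesis
    proof (rule that; rule order_below_reduce)
      show "order_below (Suc n) (A - T * F2)" "order_below (Suc n) (B - F1 * T)"
        using TF2(1) F1T(1) Suc Suc.prems by (simp_all add: order_below_diff)
      show "leading_form n (A - T * F2) = 0" "leading_form n (B - F1 * T) = 0"
        using TF2(2) F1T(2) Suc t T(2) by (simp_all add: leading_form_diff)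
    qed
  qed
  have "F1 * (A - T * F2) = (B - F1 * T) * F2"
    by (simp add: algebra_simps Suc.prems(3))
  from Suc.IH[OF T this] obtain S where "A - T * F2 = S * F2" "B - F1 * T = F1 * S"
    by blast
  then have "A = (T + S) * F2 \<and> B = F1 * (T + S)"
    by (simp add: algebra_simps)
  then show ?case by blast
qed

lemma common_multiple_factors:
  fixes F1 F2 A B :: "'a::pdiff_field lpdo"
  assumes F1: "lpdo_order F1 = 1" and F2: "lpdo_order F2 = 1"
    and cop: "coprime (lpdo_symbol F1) (lpdo_symbol F2)"
    and eq: "F1 * A = B * F2"
  obtains T where "A = T * F2" "B = F1 * T"
proof -
  define n where "n = Suc (max (lpdo_order A) (lpdo_order B))"
  have "order_below n A" "order_below n B"
    by (auto simp: n_def intro: order_below_mono[OF order_below_lpdo_order])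
  moreover have "order_below 2 F1" "order_below 2 F2"
    using order_below_lpdo_order[of F1] order_below_lpdo_order[of F2] F1 F2
    by (simp_all add: numeral_2_eq_2)
  ultimately show thesis
    using common_multiple_factors_bounded coprime_symbols_imp_det_nonzero[OF F1 F2 cop] eq that
    by blast
qed

theorem theorem5:
  fixes L F1 F2 :: "'k::pdiff_field lpdo"
  assumes "differentially_closed TYPE('k)"
    and "lpdo_order L = 3" and "lpdo_order F1 = 1" and "lpdo_order F2 = 1"
    and "coprime (lpdo_symbol F1) (lpdo_symbol F2)"
  shows "left_factor F1 L \<and> right_factor F2 L \<longleftrightarrow> (\<exists>T. L = F1 * T * F2)"
proof
  assume "left_factor F1 L \<and> right_factor F2 L"
  then obtain A B where A: "L = F1 * A" and B: "L = B * F2"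
    unfolding left_factor_def right_factor_def by blast
  then obtain T where "A = T * F2"
    using common_multiple_factors[OF assms(3-5), of A B] by metis
  then show "\<exists>T. L = F1 * T * F2"
    using A by (auto simp: mult.assoc)
next
  assume "\<exists>T. L = F1 * T * F2"
  then show "left_factor F1 L \<and> right_factor F2 L"
    unfolding left_factor_def right_factor_def by (metis mult.assoc)
qed

end
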